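(* Consider the primal-dual problem (P-D), and let $z_{\star 0}\in\mathcal Z_\star$. Then the following conditions are equivalent: (i) (Uniform quadratic growth of reduced augmented Lagrangian functions) There exist a radius $r>0$, a constant $\beta>0$ and constants $\alpha_P=\alpha_P(\beta)>0$, $\alpha_D=\alpha_D(\beta)>0$ such that for all $z_\star=(x_\star,y_\star)\in\mathcal Z_\star\cap B_r(z_{\star 0})$ and all $z=(x,y)\in\mathcal Z\cap B_r(z_{\star 0})$, $$L_\beta^P(x,y_\star)-L_\beta^P(x_\star,y_\star)\ge\tfrac{\alpha_P}{2}\operatorname{dist}^2(x,\mathcal X_\star),\qquad L_\beta^D(y,x_\star)-L_\beta^D(y_\star,x_\star)\ge\tfrac{\alpha_D}{2}\operatorname{dist}^2(y,\mathcal Y_\star).$$ (ii) (Quadratic growth of the localized smoothed gap) There exist a radius $r>0$, a constant $\beta>0$ and a constant $\alpha=\alpha(\beta)>0$ such that for all $z_\star\in\mathcal Z_\star\cap B_r(z_{\star 0})$ and all $z\in\mathcal Z\cap B_r(z_{\star 0})$, $$G_\beta(z;z_\star)\ge\tfrac{\alpha}{2}\operatorname{dist}^2(z,\mathcal Z_\star).$$ (iii) (Metric subregularity) There exist a radius $r>0$ and a constant $\gamma>0$ such that for all $z\in\mathcal Z\cap B_r(z_{\star 0})$, $$\gamma\operatorname{dist}(z,\mathcal Z_\star)\le\operatorname{dist}(0,\mathcal F(z)).$$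
   Context: $\mathbf E,\mathbf F$ are finite-dimensional Euclidean spaces; $\mathcal Z=\mathbf E\times\mathbf F$; $A:\mathbf E\to\mathbf F$ is linear with adjoint $A^\top$; $b\in\mathbf F$, $c\in\mathbf E$; $\mathcal K\subset\mathbf E$ is a closed convex cone with dual cone $\mathcal K^*=\{s:\langle s,x\rangle\ge0\ \forall x\in\mathcal K\}$. (P): $\min\{\langle c,x\rangle:Ax=b,\ x\in\mathcal K\}$. (D): $\max\{-\langle b,y\rangle: c+A^\top y=s,\ s\in\mathcal K^*,\ y\in\mathbf F\}$. (P-D): $\min_x\max_y L(x,y)$ with $L(x,y)=\langle c,x\rangle+\iota_{\mathcal K}(x)+\langle Ax-b,y\rangle$, where $\iota$ denotes indicator functions. $\mathcal X_\star$ is the set of optimal $x$ of (P), $\mathcal Y_\star$ the set of optimal $y$ of (D), and $\mathcal Z_\star=\mathcal X_\star\times\mathcal Y_\star$. $B_r(z)$ is the closed ball; $\operatorname{dist}$ is Euclidean distance, with $\operatorname{dist}(0,\emptyset)=+\infty$. Put $f(x)=\langle c,x\rangle+\iota_{\mathcal K}(x)$, $g(u)=\iota_{\{b\}}(u)$, with conjugates $f^*(v)=\iota_{\mathcal K^*}(c-v)$, $g^*(y)=\langle b,y\rangle$. For $\beta>0$ the augmented Lagrangians are $L_\beta^P(x,u,y)=f(x)+g(u)+\langle y,Ax-u\rangle+\frac1{2\beta}\|Ax-u\|^2$ and $L_\beta^D(y,v,x)=f^*(v)+g^*(y)+\langle x,-A^\top y-v\rangle+\frac1{2\beta}\|A^\top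 y+v\|^2$; the reduced ones are $L_\beta^P(x,y)=\min_uL_\beta^P(x,u,y)$ and $L_\beta^D(y,x)=\min_vL_\beta^D(y,v,x)$. Localized smoothed gap: $G_\beta(z;z_{\rm ref})=\max_{z'=(x',y')\in\mathcal Z}\{L(x,y')-L(x',y)-\frac\beta2\|z'-z_{\rm ref}\|^2\}$ for $z=(x,y)$ (points $x'\notin\mathcal K$ are disregarded in the maximum; the value is $+\infty$ if $x\notin\mathcal K$). Saddle subdifferential: $\mathcal F(x,y)=\begin{bmatrix}c+A^\top y+N_{\mathcal K}(x)\\ b-Ax\end{bmatrix}$, where $N_{\mathcal K}(x)$ is the normal cone of $\mathcal K$ at $x$ (empty if $x\notin\mathcal K$).
   Formalization: The formal theorem additionally assumes that the optimal values of (P) and (D) coincide at z_{⋆0}, i.e. ⟨c,x_{⋆0}⟩ = −⟨b,y_{⋆0}⟩ (zero duality gap); with a positive gap (i) always fails while (iii) always holds, so the equivalence is false there. *)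

theory Defs
  imports "HOL-Analysis.Analysis"
begin

section \<open>Convex-analytic notions\<close>

definition iota :: "'a set \<Rightarrow> 'a \<Rightarrow> ereal" where
  "iota S x = (if x \<in> S then 0 else \<infinity>)"

definition dual_cone :: "'a::real_inner set \<Rightarrow> 'a set" where
  "dual_cone K = {s. \<forall>x\<in>K. 0 \<le> s \<bullet> x}"

definition normal_cone :: "'a::real_inner set \<Rightarrow> 'a \<Rightarrow> 'a set" where
  "normal_cone K x = (if x \<in> K then {v. \<forall>x'\<in>K. v \<bullet> (x' - x) \<le> 0} else {})"

definition conjugate :: "('a::real_inner \<Rightarrow> ereal) \<Rightarrow> 'a \<Rightarrow> ereal" where
  "conjugate h v = (SUP x. ereal (v \<bullet> x) - h x)"

text \<open>Unlike \<open>infdist\<close>, this distance is infinite for the empty set.\<close>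

definition edist_to :: "'a::metric_space \<Rightarrow> 'a set \<Rightarrow> ereal" where
  "edist_to x S = (INF y\<in>S. ereal (dist x y))"

section \<open>The conic program, its dual and the Lagrangian\<close>

definition primal_feasible ::
  "('e::euclidean_space \<Rightarrow> 'f::euclidean_space) \<Rightarrow> 'f \<Rightarrow> 'e set \<Rightarrow> 'e set" where
  "primal_feasible A b K = {x \<in> K. A x = b}"

definition dual_feasible ::
  "('e::euclidean_space \<Rightarrow> 'f::euclidean_space) \<Rightarrow> 'e \<Rightarrow> 'e set \<Rightarrow> 'f set" where
  "dual_feasible A c K = {y. c + adjoint A y \<in> dual_cone K}"

definition Xstar ::
  "('e::euclidean_space \<Rightarrow> 'f::euclidean_space) \<Rightarrow> 'f \<Rightarrow> 'e \<Rightarrow> 'e set \<Rightarrow> 'e set" where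
  "Xstar A b c K =
     {x \<in> primal_feasible A b K. \<forall>x'\<in>primal_feasible A b K. c \<bullet> x \<le> c \<bullet> x'}"

definition Ystar ::
  "('e::euclidean_space \<Rightarrow> 'f::euclidean_space) \<Rightarrow> 'f \<Rightarrow> 'e \<Rightarrow> 'e set \<Rightarrow> 'f set" where
  "Ystar A b c K =
     {y \<in> dual_feasible A c K. \<forall>y'\<in>dual_feasible A c K. - (b \<bullet> y') \<le> - (b \<bullet> y)}"

definition Zstar ::
  "('e::euclidean_space \<Rightarrow> 'f::euclidean_space) \<Rightarrow> 'f \<Rightarrow> 'e \<Rightarrow> 'e set \<Rightarrow> ('e \<times> 'f) set" where
  "Zstar A b c K = Xstar A b c K \<times> Ystar A b c K"

definition Lagr ::
  "('e::euclidean_space \<Rightarrow> 'f::euclidean_space) \<Rightarrow> 'f \<Rightarrow> 'e \<Rightarrow> 'e set \<Rightarrow> 'e \<Rightarrow> 'f \<Rightarrow> ereal" where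
  "Lagr A b c K x y = ereal (c \<bullet> x) + iota K x + ereal ((A x - b) \<bullet> y)"

section \<open>Augmented Lagrangians\<close>

definition obj_f :: "'e::euclidean_space \<Rightarrow> 'e set \<Rightarrow> 'e \<Rightarrow> ereal" where
  "obj_f c K x = ereal (c \<bullet> x) + iota K x"

definition obj_g :: "'f::euclidean_space \<Rightarrow> 'f \<Rightarrow> ereal" where
  "obj_g b u = iota {b} u"

lemma conjugate_obj_f:
  fixes c :: "'e::euclidean_space"
  assumes K: "convex_cone K"
  shows "conjugate (obj_f c K) v = iota (dual_cone K) (c - v)"
proof -
  have 0: "0 \<in> K"
    using K convex_cone_contains_0 by blast
  have sc: "t *\<^sub>R x \<in> K" if "x \<in> K" "t \<ge> 0" for x t
    using K that by (auto simp: convex_cone_def conic_def)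
  have at0: "ereal (v \<bullet> 0) - obj_f c K 0 = 0"
    using 0 by (simp add: obj_f_def iota_def zero_ereal_def)
  show ?thesis
  proof (cases "c - v \<in> dual_cone K")
    case True
    have "ereal (v \<bullet> x) - obj_f c K x \<le> 0" for x
    proof (cases "x \<in> K")
      case x: True
      then have "0 \<le> (c - v) \<bullet> x" using True by (auto simp: dual_cone_def)
      then show ?thesis using x
        by (simp add: obj_f_def iota_def inner_diff_left flip: zero_ereal_def)
    qed (simp add: obj_f_def iota_def)
    moreover have "0 \<le> conjugate (obj_f c K) v"
      unfolding conjugate_def by (rule SUP_upper2[of 0]) (use at0 in simp_all)
    ultimately show ?thesis
      using True by (simp add: conjugate_def iota_def SUP_le_iff order_antisym)
  next
    case False
    then obtain x where x: "x \<in> K" "(c - v) \<bullet> x < 0"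
      by (auto simp: dual_cone_def not_le)
    define d where "d = - ((c - v) \<bullet> x)"
    have d: "d > 0" using x by (simp add: d_def)
    have le: "ereal (t * d) \<le> conjugate (obj_f c K) v" if "t \<ge> 0" for t
    proof -
      have "ereal (v \<bullet> (t *\<^sub>R x)) - obj_f c K (t *\<^sub>R x) = ereal (t * d)"
        using sc[OF x(1) that]
        by (simp add: obj_f_def iota_def d_def inner_diff_left algebra_simps)
      then show ?thesis
        unfolding conjugate_def by (intro SUP_upper2[of "t *\<^sub>R x"]) simp_all
    qed
    have "ereal B \<le> conjugate (obj_f c K) v" for B
    proof -
      have "ereal B \<le> ereal (max 0 (B / d) * d)"
        using d by (auto simp: max_def field_simps)
      also have "\<dots> \<le> conjugate (obj_f c K) v" by (rule le) simp
      finally show ?thesis .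
    qed
    then have "conjugate (obj_f c K) v = \<infinity>" by (simp add: ereal_top)
    then show ?thesis using False by (simp add: iota_def)
  qed
qed

lemma conjugate_obj_g: "conjugate (obj_g b) y = ereal (b \<bullet> y)"
proof (rule antisym)
  have "ereal (y \<bullet> u) - obj_g b u \<le> ereal (b \<bullet> y)" for u
    by (auto simp: obj_g_def iota_def inner_commute)
  then show "conjugate (obj_g b) y \<le> ereal (b \<bullet> y)"
    by (simp add: conjugate_def SUP_le_iff)
  have "ereal (y \<bullet> b) - obj_g b b = ereal (b \<bullet> y)"
    by (simp add: obj_g_def iota_def inner_commute)
  then show "ereal (b \<bullet> y) \<le> conjugate (obj_g b) y"
    unfolding conjugate_def by (intro SUP_upper2[of b]) simp_all
qed

definition LP_full ::
  "('e::euclidean_space \<Rightarrow> 'f::euclidean_space) \<Rightarrow> 'f \<Rightarrow> 'e \<Rightarrow> 'e set \<Rightarrow> real \<Rightarrow> 'e \<Rightarrow> 'f \<Rightarrow> 'f \<Rightarrow> ereal"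
  where
  "LP_full A b c K \<beta> x u y =
     obj_f c K x + obj_g b u + ereal (y \<bullet> (A x - u)) + ereal (1 / (2 * \<beta>) * (norm (A x - u))\<^sup>2)"

definition LD_full ::
  "('e::euclidean_space \<Rightarrow> 'f::euclidean_space) \<Rightarrow> 'f \<Rightarrow> 'e \<Rightarrow> 'e set \<Rightarrow> real \<Rightarrow> 'f \<Rightarrow> 'e \<Rightarrow> 'e \<Rightarrow> ereal"
  where
  "LD_full A b c K \<beta> y v x =
     conjugate (obj_f c K) v + conjugate (obj_g b) y
       + ereal (x \<bullet> (- adjoint A y - v)) + ereal (1 / (2 * \<beta>) * (norm (adjoint A y + v))\<^sup>2)"

definition LP ::
  "('e::euclidean_space \<Rightarrow> 'f::euclidean_space) \<Rightarrow> 'f \<Rightarrow> 'e \<Rightarrow> 'e set \<Rightarrow> real \<Rightarrow> 'e \<Rightarrow> 'f \<Rightarrow> ereal"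
  where
  "LP A b c K \<beta> x y = (INF u. LP_full A b c K \<beta> x u y)"

definition LD ::
  "('e::euclidean_space \<Rightarrow> 'f::euclidean_space) \<Rightarrow> 'f \<Rightarrow> 'e \<Rightarrow> 'e set \<Rightarrow> real \<Rightarrow> 'f \<Rightarrow> 'e \<Rightarrow> ereal"
  where
  "LD A b c K \<beta> y x = (INF v. LD_full A b c K \<beta> y v x)"

section \<open>Smoothed gap and saddle subdifferential\<close>

text \<open>
  Only \<open>x'\<close> in \<open>K\<close> enters the supremum, so the subtracted Lagrangian value is always
  finite and the gap is infinite exactly because of \<open>Lagr\<close> when \<open>fst z\<close> lies outside \<open>K\<close>.
\<close>

definition smoothed_gap ::
  "('e::euclidean_space \<Rightarrow> 'f::euclidean_space) \<Rightarrow> 'f \<Rightarrow> 'e \<Rightarrow> 'e set \<Rightarrow> real \<Rightarrow> 'e \<times> 'f \<Rightarrow> 'e \<times> 'f \<Rightarrow> ereal"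
  where
  "smoothed_gap A b c K \<beta> z zref =
     (SUP z'\<in>K \<times> UNIV.
        Lagr A b c K (fst z) (snd z') - Lagr A b c K (fst z') (snd z)
          - ereal (\<beta> / 2 * (norm (z' - zref))\<^sup>2))"

definition saddle_subdiff ::
  "('e::euclidean_space \<Rightarrow> 'f::euclidean_space) \<Rightarrow> 'f \<Rightarrow> 'e \<Rightarrow> 'e set \<Rightarrow> 'e \<times> 'f \<Rightarrow> ('e \<times> 'f) set"
  where
  "saddle_subdiff A b c K z =
     {(c + adjoint A (snd z) + v, b - A (fst z)) | v. v \<in> normal_cone K (fst z)}"

section \<open>The three regularity conditions\<close>

text \<open>
  The distances to \<open>Xstar\<close>, \<open>Ystar\<close> and \<open>Zstar\<close> are \<open>infdist\<close>: below, these sets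
  contain the components of \<open>z0\<close>, hence are nonempty.
\<close>

definition AL_quadratic_growth ::
  "('e::euclidean_space \<Rightarrow> 'f::euclidean_space) \<Rightarrow> 'f \<Rightarrow> 'e \<Rightarrow> 'e set \<Rightarrow> 'e \<times> 'f \<Rightarrow> bool" where
  "AL_quadratic_growth A b c K z0 \<longleftrightarrow>
     (\<exists>r>0. \<exists>\<beta>>0. \<exists>\<alpha>P>0. \<exists>\<alpha>D>0.
        \<forall>xs ys x y. (xs, ys) \<in> Zstar A b c K \<inter> cball z0 r \<longrightarrow> (x, y) \<in> cball z0 r \<longrightarrow>
          LP A b c K \<beta> x ys - LP A b c K \<beta> xs ys
            \<ge> ereal (\<alpha>P / 2 * (infdist x (Xstar A b c K))\<^sup>2) \<and>
          LD A b c K \<beta> y xs - LD A b c K \<beta> ys xs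
            \<ge> ereal (\<alpha>D / 2 * (infdist y (Ystar A b c K))\<^sup>2))"

definition gap_quadratic_growth ::
  "('e::euclidean_space \<Rightarrow> 'f::euclidean_space) \<Rightarrow> 'f \<Rightarrow> 'e \<Rightarrow> 'e set \<Rightarrow> 'e \<times> 'f \<Rightarrow> bool" where
  "gap_quadratic_growth A b c K z0 \<longleftrightarrow>
     (\<exists>r>0. \<exists>\<beta>>0. \<exists>\<alpha>>0.
        \<forall>zs\<in>Zstar A b c K \<inter> cball z0 r. \<forall>z\<in>cball z0 r.
          smoothed_gap A b c K \<beta> z zs \<ge> ereal (\<alpha> / 2 * (infdist z (Zstar A b c K))\<^sup>2))"

definition metric_subregularity ::
  "('e::euclidean_space \<Rightarrow> 'f::euclidean_space) \<Rightarrow> 'f \<Rightarrow> 'e \<Rightarrow> 'e set \<Rightarrow> 'e \<times> 'f \<Rightarrow> bool" where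
  "metric_subregularity A b c K z0 \<longleftrightarrow>
     (\<exists>r>0. \<exists>\<gamma>>0. \<forall>z\<in>cball z0 r.
        ereal (\<gamma> * infdist z (Zstar A b c K)) \<le> edist_to 0 (saddle_subdiff A b c K z))"

end

theory Submission
  imports Defs
begin

text \<open>
  Write \<open>w(y) = c + A\<^sup>T y\<close>. By strong duality and complementarity the two growth gaps in (i) are
  \<open>P(x) = \<langle>w(y\<^sub>\<star>), x\<rangle> + \<parallel>A x - b\<parallel>\<^sup>2 / (2 \<beta>)\<close> for \<open>x \<in> K\<close>, and \<open>D(y)\<close>, the minimum over the
  dual cone of \<open>\<langle>x\<^sub>\<star>, s\<rangle> + \<parallel>w(y) - s\<parallel>\<^sup>2 / (2 \<beta>)\<close>. It suffices to go around the cycle.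

  (i) to (ii): by Moreau's decomposition, \<open>G\<^sub>\<beta>(z; z\<^sub>\<star>)\<close> is at least \<open>P(x) + D(y)\<close>.

  (ii) to (iii): for \<open>v \<in> F(z)\<close>, convexity-concavity of \<open>L\<close> bounds \<open>G\<^sub>\<beta>(z; z\<^sub>\<star>)\<close> by
  \<open>\<langle>v, z - z\<^sub>\<star>\<rangle> + \<parallel>v\<parallel>\<^sup>2 / (2 \<beta>)\<close>; take for \<open>z\<^sub>\<star>\<close> the solution nearest to \<open>z\<close>.

  (iii) to (i), with \<open>\<beta> = 1\<close>: let \<open>u\<close> be the proximal point of \<open>P\<close> at \<open>x\<close>. Optimality of \<open>u\<close> says that
  \<open>(x - u, b - A u)\<close> lies in \<open>F(u, y\<^sub>\<star> + A u - b)\<close>, and both components are \<open>O(P(x)\<^sup>1\<^sup>/\<^sup>2)\<close>,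
  so subregularity bounds the distance of \<open>u\<close>, hence of \<open>x\<close>, to the optimal set. The dual part is
  the same with the proximal point of \<open>D\<close>.
\<close>

section \<open>Constrained least squares with a linear term\<close>

text \<open>Divide by \<open>t\<close> and let it tend to 0 from the right. This turns a comparison
  of values along a segment into a first-order condition.\<close>

lemma linear_coeff_nonneg:
  fixes l m :: real
  assumes "\<And>t. 0 < t \<Longrightarrow> t \<le> 1 \<Longrightarrow> 0 \<le> t * l + t\<^sup>2 * m"
  shows "0 \<le> l"
proof (rule tendsto_lowerbound)
  show "((\<lambda>t. l + t * m) \<longlongrightarrow> l) (at_right 0)"
    by (auto intro!: tendsto_eq_intros)
  show "\<forall>\<^sub>F t in at_right 0. 0 \<le> l + t * m"
    unfolding eventually_at_right_field
  proof (intro exI[of _ 1] conjI allI impI)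
    fix t :: real
    assume t: "0 < t" "t < 1"
    then have "0 \<le> t * (l + t * m)"
      using assms[of t] by (simp add: algebra_simps power2_eq_square)
    then show "0 \<le> l + t * m"
      using t by (simp add: zero_le_mult_iff)
  qed simp
qed simp

text \<open>An injective linear \<open>B\<close> is bounded below, and the linear term is
  nonnegative on \<open>S\<close>, so sublevel sets of the objective are bounded and a minimizer
  exists by compactness. Stacking the penalty and the proximal term into one map \<open>B\<close>
  lets the primal and the dual proximal problem share this lemma.\<close>

lemma regularized_least_squares:
  fixes B :: "'v::euclidean_space \<Rightarrow> 'w::euclidean_space"
  assumes S: "closed S" "convex S" "S \<noteq> {}"
    and B: "linear B" "inj B"
    and g: "\<And>v. v \<in> S \<Longrightarrow> 0 \<le> g \<bullet> v"
  obtains v where "v \<in> S"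
    and "\<And>v'. v' \<in> S \<Longrightarrow> g \<bullet> v + 1/2 * (norm (B v - q))\<^sup>2 \<le> g \<bullet> v' + 1/2 * (norm (B v' - q))\<^sup>2"
    and "\<And>v'. v' \<in> S \<Longrightarrow> 0 \<le> g \<bullet> (v' - v) + (B v - q) \<bullet> B (v' - v)"
proof -
  define h where "h v = g \<bullet> v + 1/2 * (norm (B v - q))\<^sup>2" for v
  obtain v0 where v0: "v0 \<in> S" using S by auto
  obtain k where k: "k > 0" "\<And>v. k * norm v \<le> norm (B v)"
    using linear_inj_bounded_below_pos[OF B] by blast
  define R where "R = (norm q + sqrt (2 * h v0)) / k"
  have bound: "norm v \<le> R" if "v \<in> S" "h v \<le> h v0" for v
  proof -
    have "(norm (B v - q))\<^sup>2 \<le> 2 * h v0"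
      using g[OF that(1)] that(2) by (simp add: h_def)
    then have "norm (B v - q) \<le> sqrt (2 * h v0)"
      by (rule real_le_rsqrt)
    moreover have "norm (B v) \<le> norm (B v - q) + norm q"
      using norm_triangle_ineq[of "B v - q" q] by simp
    ultimately show ?thesis
      using k(1) k(2)[of v] by (simp add: R_def field_simps)
  qed
  have cont: "continuous_on T h" for T
    unfolding h_def using B(1)
    by (intro continuous_intros linear_continuous_on) (simp_all add: linear_conv_bounded_linear)
  have "compact (S \<inter> cball 0 R)" "S \<inter> cball 0 R \<noteq> {}"
    using S v0 bound[OF v0] by (auto simp: closed_Int_compact)
  then obtain v where v: "v \<in> S \<inter> cball 0 R" "\<forall>v'\<in>S \<inter> cball 0 R. h v \<le> h v'"
    using continuous_attains_inf[OF _ _ cont] by blast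
  have "h v \<le> h v0"
    using v v0 bound[OF v0] by auto
  then have min: "h v \<le> h v'" if "v' \<in> S" for v'
    using v bound[of v'] that by (cases "h v' \<le> h v0") auto
  have "0 \<le> g \<bullet> (v' - v) + (B v - q) \<bullet> B (v' - v)" if v': "v' \<in> S" for v'
  proof (rule linear_coeff_nonneg[where m = "1/2 * (norm (B (v' - v)))\<^sup>2"])
    fix t :: real
    assume t: "0 < t" "t \<le> 1"
    have "v + t *\<^sub>R (v' - v) = (1 - t) *\<^sub>R v + t *\<^sub>R v'"
      by (simp add: algebra_simps)
    then have "v + t *\<^sub>R (v' - v) \<in> S"
      using convexD[OF S(2) _ v', of v "1 - t" t] v t by auto
    then have "h v \<le> h (v + t *\<^sub>R (v' - v))"
      by (rule min)
    moreover have "B (v + t *\<^sub>R (v' - v)) - q = (B v - q) + t *\<^sub>R B (v' - v)"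
      using B(1) by (simp add: linear_add linear_cmul)
    moreover have "(norm ((B v - q) + t *\<^sub>R B (v' - v)))\<^sup>2
        = (norm (B v - q))\<^sup>2 + 2 * t * ((B v - q) \<bullet> B (v' - v)) + t\<^sup>2 * (norm (B (v' - v)))\<^sup>2"
      unfolding power2_norm_eq_inner
      by (simp only: inner_add_left inner_add_right inner_scaleR_left inner_scaleR_right
          inner_commute[of "B (v' - v)" "B v - q"])
        (simp add: algebra_simps power2_eq_square)
    ultimately show "0 \<le> t * (g \<bullet> (v' - v) + (B v - q) \<bullet> B (v' - v))
        + t\<^sup>2 * (1/2 * (norm (B (v' - v)))\<^sup>2)"
      unfolding h_def by (simp add: inner_add_right algebra_simps)
  qed
  then show thesis
    using that[of v] v min unfolding h_def by blast
qed

section \<open>Projection onto a closed convex cone and its dual\<close>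

text \<open>Moreau's decomposition: testing the variational inequality of the projection at
  \<open>2 *\<^sub>R p a\<close> and at 0 gives the orthogonality, after which the inequality itself
  is membership in the dual cone.\<close>

lemma closest_point_cone:
  fixes K :: "'a::euclidean_space set"
  assumes "closed K" "convex_cone K"
  defines "p \<equiv> closest_point K"
  shows "p a \<in> K" and "p a - a \<in> dual_cone K" and "(p a - a) \<bullet> p a = 0"
proof -
  have K: "convex K" "K \<noteq> {}" "conic K"
    using assms(2) by (auto simp: convex_cone_def)
  show pK: "p a \<in> K"
    unfolding p_def using assms(1) K by (simp add: closest_point_in_set)
  have opt: "0 \<le> (p a - a) \<bullet> (x - p a)" if "x \<in> K" for x
    using closest_point_dot[OF K(1) assms(1) that, of a]
    by (simp add: p_def inner_diff_left)
  have "2 *\<^sub>R p a \<in> K" "0 \<in> K"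
    using pK assms(2) by (auto simp: convex_cone_def conic_def convex_cone_contains_0)
  from opt[OF this(1)] opt[OF this(2)] show 0: "(p a - a) \<bullet> p a = 0"
    by (simp add: algebra_simps)
  show "p a - a \<in> dual_cone K"
    using opt 0 by (simp add: dual_cone_def inner_diff_right)
qed

text \<open>The residual \<open>p - x\<close> of the projection is in the dual cone and orthogonal
  to \<open>p\<close>; pairing it with \<open>x\<close> shows that its squared norm is at most
  0.\<close>

lemma bipolar:
  fixes K :: "'a::euclidean_space set"
  assumes "closed K" "convex_cone K" and x: "\<And>s. s \<in> dual_cone K \<Longrightarrow> 0 \<le> s \<bullet> x"
  shows "x \<in> K"
proof -
  define p where "p = closest_point K x"
  have p: "p \<in> K" "p - x \<in> dual_cone K" "(p - x) \<bullet> p = 0"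
    unfolding p_def using closest_point_cone[OF assms(1,2)] by auto
  have "(p - x) \<bullet> (p - x) \<le> 0"
    using x[OF p(2)] p(3) by (simp only: inner_diff_right)
  then have "p - x = 0"
    using inner_gt_zero_iff[of "p - x"] by (meson not_le)
  then show ?thesis
    using p(1) by simp
qed

lemma closed_dual_cone: "closed (dual_cone K)"
proof -
  have "dual_cone K = (\<Inter>x\<in>K. {s. 0 \<le> s \<bullet> x})"
    by (auto simp: dual_cone_def)
  then show ?thesis
    by (auto intro!: closed_INT closed_Collect_le continuous_intros)
qed

lemma convex_dual_cone: "convex (dual_cone K)"
  unfolding convex_def by (auto simp: dual_cone_def inner_add_left)

lemma scaleR_dual_cone: "s \<in> dual_cone K \<Longrightarrow> 0 \<le> t \<Longrightarrow> t *\<^sub>R s \<in> dual_cone K"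
  by (auto simp: dual_cone_def)

lemma normal_coneI:
  assumes "s \<in> dual_cone K" "x \<in> K" "s \<bullet> x = 0"
  shows "- s \<in> normal_cone K x"
  using assms by (auto simp: normal_cone_def dual_cone_def inner_diff_right)

section \<open>Distances to product sets\<close>

lemma infdist_fst_le:
  assumes "X \<noteq> {}" "Y \<noteq> {}"
  shows "infdist x X \<le> infdist (x, y) (X \<times> Y)"
proof -
  have "infdist x X \<le> dist (x, y) p" if "p \<in> X \<times> Y" for p
  proof -
    have "infdist x X \<le> dist x (fst p)" using that by (auto intro: infdist_le)
    also have "\<dots> \<le> dist (x, y) p" using dist_fst_le[of "(x, y)" p] by simp
    finally show ?thesis .
  qed
  then show ?thesis
    using assms by (auto simp: infdist_def intro!: cINF_greatest)
qed

lemma infdist_snd_le: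
  assumes "X \<noteq> {}" "Y \<noteq> {}"
  shows "infdist y Y \<le> infdist (x, y) (X \<times> Y)"
proof -
  have "infdist y Y \<le> dist (x, y) p" if "p \<in> X \<times> Y" for p
  proof -
    have "infdist y Y \<le> dist y (snd p)" using that by (auto intro: infdist_le)
    also have "\<dots> \<le> dist (x, y) p" using dist_snd_le[of "(x, y)" p] by simp
    finally show ?thesis .
  qed
  then show ?thesis
    using assms by (auto simp: infdist_def intro!: cINF_greatest)
qed

lemma infdist_Times_le:
  fixes X :: "'a::heine_borel set" and Y :: "'b::heine_borel set"
  assumes "closed X" "closed Y" "X \<noteq> {}" "Y \<noteq> {}"
  shows "(infdist (x, y) (X \<times> Y))\<^sup>2 \<le> (infdist x X)\<^sup>2 + (infdist y Y)\<^sup>2"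
proof -
  obtain p q where p: "p \<in> X" "infdist x X = dist x p" and q: "q \<in> Y" "infdist y Y = dist y q"
    using infdist_attains_inf[of X x] infdist_attains_inf[of Y y] assms by metis
  have "infdist (x, y) (X \<times> Y) \<le> dist (x, y) (p, q)"
    using p q by (intro infdist_le) auto
  then have "(infdist (x, y) (X \<times> Y))\<^sup>2 \<le> (dist (x, y) (p, q))\<^sup>2"
    by (intro power_mono infdist_nonneg)
  then show ?thesis
    by (simp add: p q dist_Pair_Pair)
qed

lemma norm_Pair_le_add: "norm (x, y) \<le> norm x + norm y"
  by (simp add: norm_Pair sqrt_sum_squares_le_sum)

text \<open>
  In both uses, \<open>a\<close> is the length of the proximal step, \<open>e\<close> the infeasibility of the proximal point,
  \<open>d'\<close> and \<open>d\<close> the distances of the proximal point and of the original point to the optimal set.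
\<close>

lemma quadratic_growth_estimate:
  fixes \<gamma> a e d d' p :: real
  assumes "\<gamma> > 0" "0 \<le> a" "0 \<le> e" "0 \<le> d"
    and "\<gamma> * d' \<le> a + e" "d \<le> d' + a" "1/2 * e\<^sup>2 + 1/2 * a\<^sup>2 \<le> p"
  shows "(\<gamma>\<^sup>2 / (2 * (1 + \<gamma>)\<^sup>2)) / 2 * d\<^sup>2 \<le> p"
proof -
  have "\<gamma> * d \<le> \<gamma> * d' + \<gamma> * a"
    using mult_left_mono[OF assms(6), of \<gamma>] assms(1) by (simp add: algebra_simps)
  also have "\<dots> \<le> (1 + \<gamma>) * (a + e)"
    using assms(5) mult_nonneg_nonneg[OF less_imp_le[OF assms(1)] assms(3)]
    by (simp add: algebra_simps)
  finally have "(\<gamma> * d)\<^sup>2 \<le> ((1 + \<gamma>) * (a + e))\<^sup>2"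
    using assms by (intro power_mono) auto
  also have "\<dots> \<le> (1 + \<gamma>)\<^sup>2 * (4 * p)"
  proof -
    have "(a + e)\<^sup>2 \<le> 2 * a\<^sup>2 + 2 * e\<^sup>2"
      using sum_squares_bound[of a e] by (simp add: power2_sum)
    then have "(a + e)\<^sup>2 \<le> 4 * p"
      using assms(7) by linarith
    then show ?thesis
      by (simp add: power_mult_distrib mult_left_mono)
  qed
  finally show ?thesis
    using assms(1) by (simp add: field_simps power_mult_distrib)
qed

section \<open>Solution sets under strong duality\<close>

locale conic_program =
  fixes A :: "'e::euclidean_space \<Rightarrow> 'f::euclidean_space"
    and b :: 'f and c :: 'e and K :: "'e set" and z0 :: "'e \<times> 'f"
  assumes linear_A: "linear A"
    and closed_K: "closed K" and cone_K: "convex_cone K"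
    and z0: "z0 \<in> Zstar A b c K"
    and strong_duality: "c \<bullet> fst z0 = - (b \<bullet> snd z0)"
begin

abbreviation "X \<equiv> Xstar A b c K"
abbreviation "Y \<equiv> Ystar A b c K"
abbreviation "w \<equiv> \<lambda>y. c + adjoint A y"

lemma inner_adjoint: "x \<bullet> adjoint A y = A x \<bullet> y" "adjoint A y \<bullet> x = A x \<bullet> y"
  using adjoint_works[OF linear_A, of x y] by (simp_all add: inner_commute)

lemma linear_adjoint: "linear (adjoint A)"
  using linear_A by (rule adjoint_linear)

lemma z0_mem: "fst z0 \<in> X" "snd z0 \<in> Y"
  using z0 by (auto simp: Zstar_def)

lemma optimal_values:
  shows "x \<in> X \<Longrightarrow> c \<bullet> x = c \<bullet> fst z0" and "y \<in> Y \<Longrightarrow> b \<bullet> y = b \<bullet> snd z0"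
proof -
  assume "x \<in> X"
  then show "c \<bullet> x = c \<bullet> fst z0"
    using z0_mem(1) unfolding Xstar_def by (blast intro: order_antisym)
next
  assume "y \<in> Y"
  then have "- (b \<bullet> y) = - (b \<bullet> snd z0)"
    using z0_mem(2) unfolding Ystar_def by (blast intro: order_antisym)
  then show "b \<bullet> y = b \<bullet> snd z0"
    by simp
qed

text \<open>The known solution \<open>z0\<close> supplies the optimal value, so optimality becomes a
  linear equation; closedness is read off from this form.\<close>

lemma X_eq: "X = {x \<in> K. A x = b \<and> c \<bullet> x = c \<bullet> fst z0}" (is "_ = ?R")
proof
  show "X \<subseteq> ?R"
  proof
    fix x assume "x \<in> X"
    then show "x \<in> ?R"
      using optimal_values(1)[of x] by (simp add: Xstar_def primal_feasible_def)
  qed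
  show "?R \<subseteq> X"
    using z0_mem(1) by (simp add: Xstar_def primal_feasible_def subset_iff)
qed

lemma Y_eq: "Y = {y. w y \<in> dual_cone K \<and> b \<bullet> y = b \<bullet> snd z0}" (is "_ = ?R")
proof
  show "Y \<subseteq> ?R"
  proof
    fix y assume "y \<in> Y"
    then show "y \<in> ?R"
      using optimal_values(2)[of y] by (simp add: Ystar_def dual_feasible_def)
  qed
  show "?R \<subseteq> Y"
    using z0_mem(2) by (simp add: Ystar_def dual_feasible_def subset_iff)
qed

lemma closed_X: "closed X"
proof -
  have "continuous_on UNIV A"
    using linear_A by (simp add: linear_continuous_on linear_conv_bounded_linear)
  then have "closed (A -` {b})"
    by (intro closed_vimage closed_singleton)
  moreover have "X = K \<inter> A -` {b} \<inter> {x. c \<bullet> x = c \<bullet> fst z0}"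
    unfolding X_eq by auto
  ultimately show ?thesis
    using closed_K closed_hyperplane[of c] by (simp add: closed_Int)
qed

lemma closed_Y: "closed Y"
proof -
  have "continuous_on UNIV w"
    using linear_adjoint
    by (intro continuous_intros linear_continuous_on) (simp add: linear_conv_bounded_linear)
  then have "closed (w -` dual_cone K)"
    by (intro closed_vimage closed_dual_cone)
  moreover have "Y = w -` dual_cone K \<inter> {y. b \<bullet> y = b \<bullet> snd z0}"
    unfolding Y_eq by auto
  ultimately show ?thesis
    using closed_hyperplane[of b] by (simp add: closed_Int)
qed

section \<open>Augmented Lagrangians and smoothed gap at a pair of solutions\<close>

context
  fixes xs ys
  assumes xs: "xs \<in> X" and ys: "ys \<in> Y"
begin

lemma xs_feasible: "xs \<in> K" "A xs = b"
  using xs by (auto simp: X_eq)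

lemma ys_feasible: "w ys \<in> dual_cone K"
  using ys by (auto simp: Y_eq)

lemma values_eq: "c \<bullet> xs = - (b \<bullet> ys)"
  using xs ys strong_duality by (simp add: X_eq Y_eq)

lemma complementarity: "w ys \<bullet> xs = 0"
  using values_eq by (simp add: inner_add_left inner_adjoint xs_feasible)

text \<open>The indicator \<open>obj_g\<close> forces \<open>u = b\<close>. At \<open>xs\<close> the
  penalty vanishes, and \<open>values_eq\<close> cancels the constants.\<close>

lemma LP_diff:
  "LP A b c K \<beta> x ys - LP A b c K \<beta> xs ys =
     (if x \<in> K then ereal (w ys \<bullet> x + 1 / (2 * \<beta>) * (norm (A x - b))\<^sup>2) else \<infinity>)"
proof -
  have LP: "LP A b c K \<beta> x y =
      obj_f c K x + ereal (y \<bullet> (A x - b) + 1 / (2 * \<beta>) * (norm (A x - b))\<^sup>2)" for x y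
  proof (unfold LP_def, rule antisym)
    show "(INF u. LP_full A b c K \<beta> x u y)
        \<le> obj_f c K x + ereal (y \<bullet> (A x - b) + 1 / (2 * \<beta>) * (norm (A x - b))\<^sup>2)"
      by (rule INF_lower2[of b]) (auto simp: LP_full_def obj_g_def obj_f_def iota_def)
    show "obj_f c K x + ereal (y \<bullet> (A x - b) + 1 / (2 * \<beta>) * (norm (A x - b))\<^sup>2)
        \<le> (INF u. LP_full A b c K \<beta> x u y)"
    proof (rule INF_greatest)
      fix u
      show "obj_f c K x + ereal (y \<bullet> (A x - b) + 1 / (2 * \<beta>) * (norm (A x - b))\<^sup>2)
        \<le> LP_full A b c K \<beta> x u y"
        by (cases "u = b") (auto simp: LP_full_def obj_g_def obj_f_def iota_def)
    qed
  qed
  show ?thesis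
    using values_eq xs_feasible
    by (simp add: LP obj_f_def iota_def inner_add_left inner_adjoint inner_diff_right
        inner_commute[of ys])
qed

text \<open>The substitution \<open>s = c - v\<close> moves the constraint to the dual cone. Since
  \<open>A xs = b\<close>, the terms linear in \<open>y\<close> cancel, so \<open>y\<close> enters
  only through the penalty.\<close>

lemma LD_full_eq:
  "LD_full A b c K \<beta> y v xs =
     (if c - v \<in> dual_cone K
      then ereal (xs \<bullet> (c - v) + 1 / (2 * \<beta>) * (norm (w y - (c - v)))\<^sup>2 + b \<bullet> ys) else \<infinity>)"
proof -
  have "w y - (c - v) = adjoint A y + v"
    by simp
  moreover have "b \<bullet> y + xs \<bullet> (- adjoint A y - v) = xs \<bullet> (c - v) + b \<bullet> ys"
    using values_eq xs_feasible
    by (simp add: inner_diff_right inner_adjoint inner_commute)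
  ultimately show ?thesis
    by (simp add: LD_full_def conjugate_obj_f[OF cone_K] conjugate_obj_g iota_def)
qed

text \<open>This lemma and the next bound the infimum from either side, without choosing a
  minimizing \<open>s\<close>.\<close>

lemma LD_le:
  assumes "s \<in> dual_cone K"
  shows "LD A b c K \<beta> y xs \<le> ereal (xs \<bullet> s + 1 / (2 * \<beta>) * (norm (w y - s))\<^sup>2 + b \<bullet> ys)"
  unfolding LD_def by (rule INF_lower2[of "c - s"]) (use assms in \<open>simp_all add: LD_full_eq\<close>)

lemma LD_ge:
  assumes "\<And>s. s \<in> dual_cone K \<Longrightarrow> t \<le> xs \<bullet> s + 1 / (2 * \<beta>) * (norm (w y - s))\<^sup>2"
  shows "ereal (t + b \<bullet> ys) \<le> LD A b c K \<beta> y xs"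
  unfolding LD_def LD_full_eq
proof (rule INF_greatest)
  fix v
  show "ereal (t + b \<bullet> ys) \<le>
      (if c - v \<in> dual_cone K
       then ereal (xs \<bullet> (c - v) + 1 / (2 * \<beta>) * (norm (w y - (c - v)))\<^sup>2 + b \<bullet> ys) else \<infinity>)"
    using assms[of "c - v"] by simp
qed

lemma inner_dual_cone_nonneg: "s \<in> dual_cone K \<Longrightarrow> 0 \<le> xs \<bullet> s"
  using xs_feasible by (auto simp: dual_cone_def inner_commute)

lemma LD_optimal:
  assumes "\<beta> > 0"
  shows "LD A b c K \<beta> ys xs = ereal (b \<bullet> ys)"
proof (rule antisym)
  show "LD A b c K \<beta> ys xs \<le> ereal (b \<bullet> ys)"
    using LD_le[OF ys_feasible, of \<beta> ys] complementarity by (simp add: inner_commute)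
  show "ereal (b \<bullet> ys) \<le> LD A b c K \<beta> ys xs"
    using LD_ge[of 0 \<beta> ys] inner_dual_cone_nonneg assms by simp
qed

lemma LD_diff_le:
  assumes "\<beta> > 0" "s \<in> dual_cone K"
  shows "LD A b c K \<beta> y xs - LD A b c K \<beta> ys xs
    \<le> ereal (xs \<bullet> s + 1 / (2 * \<beta>) * (norm (w y - s))\<^sup>2)"
  using LD_le[OF assms(2), of \<beta> y] unfolding LD_optimal[OF assms(1)]
  by (simp add: ereal_minus_le)

lemma LD_diff_ge:
  assumes "\<beta> > 0"
    and "\<And>s. s \<in> dual_cone K \<Longrightarrow> t \<le> xs \<bullet> s + 1 / (2 * \<beta>) * (norm (w y - s))\<^sup>2"
  shows "ereal t \<le> LD A b c K \<beta> y xs - LD A b c K \<beta> ys xs"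
  using LD_ge[OF assms(2)] unfolding LD_optimal[OF assms(1)]
  by (simp add: ereal_le_minus)

lemma smoothed_gap_outside:
  assumes "x \<notin> K"
  shows "smoothed_gap A b c K \<beta> (x, y) zs = \<infinity>"
proof -
  have "\<infinity> \<le> smoothed_gap A b c K \<beta> (x, y) zs"
    unfolding smoothed_gap_def
    by (rule SUP_upper2[of "(xs, ys)"]) (use assms xs_feasible in \<open>auto simp: Lagr_def iota_def\<close>)
  then show ?thesis by simp
qed

text \<open>The maximization in the gap separates into \<open>x'\<close> and \<open>y'\<close>.
  Inserting the maximizer of each part gives one primal and one dual growth term.\<close>

lemma smoothed_gap_ge:
  assumes \<beta>: "\<beta> > 0" and x: "x \<in> K"
  obtains s where "s \<in> dual_cone K"
    and "ereal (w ys \<bullet> x + 1 / (2 * \<beta>) * (norm (A x - b))\<^sup>2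
           + (xs \<bullet> s + 1 / (2 * \<beta>) * (norm (w y - s))\<^sup>2)) \<le> smoothed_gap A b c K \<beta> (x, y) (xs, ys)"
proof -
  \<comment> \<open>Completing the square in \<open>x'\<close> shows that the best \<open>x'\<close>
    in \<open>K\<close> is the projection of \<open>a\<close>. Its rescaled Moreau residual
    \<open>s\<close> is the dual candidate.\<close>
  define a where "a = xs - (1 / \<beta>) *\<^sub>R w y"
  define p where "p = closest_point K a"
  define s where "s = \<beta> *\<^sub>R (p - a)"
  have p: "p \<in> K" "p - a \<in> dual_cone K" "(p - a) \<bullet> p = 0"
    unfolding p_def using closest_point_cone[OF closed_K cone_K] by auto
  have s: "s \<in> dual_cone K" "s \<bullet> p = 0"
    using p \<beta> by (auto simp: s_def intro: scaleR_dual_cone)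
  define d where "d = p - xs"
  have ws: "w y = s - \<beta> *\<^sub>R d"
    using \<beta> by (simp add: s_def a_def d_def algebra_simps)
  define f where "f = A x - b"
  have f_sq: "f \<bullet> f = (norm f)\<^sup>2" and d_sq: "d \<bullet> d = (norm d)\<^sup>2"
    by (simp_all add: power2_norm_eq_inner)
  \<comment> \<open>The point \<open>ys + (1 / \<beta>) *\<^sub>R f\<close> maximizes the concave
    quadratic in \<open>y'\<close>.\<close>
  have primal: "c \<bullet> x + f \<bullet> (ys + (1 / \<beta>) *\<^sub>R f) - \<beta> / 2 * (norm ((1 / \<beta>) *\<^sub>R f))\<^sup>2
      = c \<bullet> xs + (w ys \<bullet> x + 1 / (2 * \<beta>) * (norm f)\<^sup>2)"
  proof -
    have "f \<bullet> ys = A x \<bullet> ys - b \<bullet> ys"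
      by (simp add: f_def inner_diff_left)
    moreover have "f \<bullet> ((1 / \<beta>) *\<^sub>R f) - \<beta> / 2 * (norm ((1 / \<beta>) *\<^sub>R f))\<^sup>2 = 1 / (2 * \<beta>) * (norm f)\<^sup>2"
      using \<beta> by (simp add: f_sq power_divide) (simp add: field_simps power2_eq_square)
    ultimately show ?thesis
      using values_eq by (simp add: inner_add_left inner_add_right inner_adjoint)
  qed
  have dual: "- (c \<bullet> p + (A p - b) \<bullet> y) - \<beta> / 2 * (norm d)\<^sup>2
      = - (c \<bullet> xs) + (xs \<bullet> s + 1 / (2 * \<beta>) * (norm (w y - s))\<^sup>2)"
  proof -
    have "c \<bullet> p + (A p - b) \<bullet> y - c \<bullet> xs = w y \<bullet> d"
      using xs_feasible
      by (simp add: d_def inner_diff_right inner_diff_left inner_add_left inner_adjoint)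
    also have "\<dots> = - (xs \<bullet> s) - \<beta> * (norm d)\<^sup>2"
      using s(2) by (simp add: ws inner_diff_left d_sq) (simp add: d_def inner_diff_right inner_commute)
    finally have "c \<bullet> p + (A p - b) \<bullet> y = c \<bullet> xs - xs \<bullet> s - \<beta> * (norm d)\<^sup>2"
      by simp
    moreover have "1 / (2 * \<beta>) * (norm (w y - s))\<^sup>2 = \<beta> / 2 * (norm d)\<^sup>2"
      using \<beta> by (simp add: ws power_mult_distrib power2_eq_square)
    ultimately show ?thesis
      by (simp add: field_simps)
  qed
  have "(norm ((p, ys + (1 / \<beta>) *\<^sub>R f) - (xs, ys)))\<^sup>2 = (norm d)\<^sup>2 + (norm ((1 / \<beta>) *\<^sub>R f))\<^sup>2"
    by (simp only: norm_Pair diff_Pair d_def add_diff_cancel_left' real_sqrt_pow2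
        sum_power2_ge_zero)
  then have "ereal (w ys \<bullet> x + 1 / (2 * \<beta>) * (norm f)\<^sup>2
           + (xs \<bullet> s + 1 / (2 * \<beta>) * (norm (w y - s))\<^sup>2))
      = Lagr A b c K x (ys + (1 / \<beta>) *\<^sub>R f) - Lagr A b c K p y
          - ereal (\<beta> / 2 * (norm ((p, ys + (1 / \<beta>) *\<^sub>R f) - (xs, ys)))\<^sup>2)"
    using primal dual x p(1)
    by (simp only: Lagr_def iota_def f_def[symmetric] if_True add_0_right plus_ereal.simps
        ereal_minus ereal.inject) (simp only: distrib_left)
  also have "\<dots> \<le> smoothed_gap A b c K \<beta> (x, y) (xs, ys)"
    unfolding smoothed_gap_def using p(1)
    by (intro SUP_upper2[of "(p, ys + (1 / \<beta>) *\<^sub>R f)"]) simp_all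
  finally show thesis
    using that s(1) unfolding f_def by blast
qed

end

lemma smoothed_gap_le:
  assumes \<beta>: "\<beta> > 0" and v: "v \<in> saddle_subdiff A b c K z"
  shows "smoothed_gap A b c K \<beta> z zs \<le> ereal (v \<bullet> (z - zs) + 1 / (2 * \<beta>) * (norm v)\<^sup>2)"
  unfolding smoothed_gap_def
proof (rule SUP_least)
  fix z' :: "'e \<times> 'f"
  assume z': "z' \<in> K \<times> UNIV"
  obtain x y x' y' where [simp]: "z = (x, y)" "z' = (x', y')"
    by fastforce
  from v obtain n where n: "v = (w y + n, b - A x)" "n \<in> normal_cone K x"
    by (auto simp: saddle_subdiff_def)
  then have x: "x \<in> K" "n \<bullet> (x' - x) \<le> 0"
    using z' by (auto simp: normal_cone_def split: if_splits)
  \<comment> \<open>The two sides differ only by the product of \<open>n\<close> with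
    \<open>x - x'\<close>, which is nonnegative because \<open>n\<close> is normal to
    \<open>K\<close> at \<open>x\<close>.\<close>
  have "c \<bullet> x + (A x - b) \<bullet> y' - (c \<bullet> x' + (A x' - b) \<bullet> y) \<le> v \<bullet> (z - z')"
    using x(2) linear_A
    by (simp add: n inner_add_left inner_diff_left inner_diff_right inner_adjoint)
  moreover have "v \<bullet> (zs - z') - \<beta> / 2 * (norm (z' - zs))\<^sup>2 \<le> 1 / (2 * \<beta>) * (norm v)\<^sup>2"
  proof -
    \<comment> \<open>Completing the square removes the dependence on \<open>z'\<close>.\<close>
    have "0 \<le> 1 / (2 * \<beta>) * (norm (v + \<beta> *\<^sub>R (z' - zs)))\<^sup>2"
      using \<beta> by simp
    also have "(norm (v + \<beta> *\<^sub>R (z' - zs)))\<^sup>2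
        = (norm v)\<^sup>2 + 2 * \<beta> * (v \<bullet> (z' - zs)) + \<beta>\<^sup>2 * (norm (z' - zs))\<^sup>2"
      unfolding power2_norm_eq_inner
      by (simp only: inner_add_left inner_add_right inner_scaleR_left inner_scaleR_right
          inner_commute[of "z' - zs" v]) (simp add: algebra_simps power2_eq_square)
    also have "1 / (2 * \<beta>) * \<dots>
        = 1 / (2 * \<beta>) * (norm v)\<^sup>2 + v \<bullet> (z' - zs) + \<beta> / 2 * (norm (z' - zs))\<^sup>2"
      using \<beta> by (simp add: field_simps power2_eq_square)
    finally show ?thesis
      by (simp add: inner_diff_right)
  qed
  ultimately have "c \<bullet> x + (A x - b) \<bullet> y' - (c \<bullet> x' + (A x' - b) \<bullet> y)
      - \<beta> / 2 * (norm (z' - zs))\<^sup>2 \<le> v \<bullet> (z - zs) + 1 / (2 * \<beta>) * (norm v)\<^sup>2"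
    unfolding inner_diff_right by linarith
  then show "Lagr A b c K (fst z) (snd z') - Lagr A b c K (fst z') (snd z)
      - ereal (\<beta> / 2 * (norm (z' - zs))\<^sup>2) \<le> ereal (v \<bullet> (z - zs) + 1 / (2 * \<beta>) * (norm v)\<^sup>2)"
    using x(1) z' by (simp add: Lagr_def iota_def)
qed

section \<open>From augmented Lagrangian growth to the gap, and on to subregularity\<close>

lemma gap_growth_if_AL_growth:
  assumes "AL_quadratic_growth A b c K z0"
  shows "gap_quadratic_growth A b c K z0"
proof -
  obtain r \<beta> \<alpha>P \<alpha>D where pos: "r > 0" "\<beta> > 0" "\<alpha>P > 0" "\<alpha>D > 0"
    and growth: "\<And>xs ys x y. (xs, ys) \<in> Zstar A b c K \<inter> cball z0 r \<Longrightarrow> (x, y) \<in> cball z0 r \<Longrightarrow>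
       LP A b c K \<beta> x ys - LP A b c K \<beta> xs ys \<ge> ereal (\<alpha>P / 2 * (infdist x X)\<^sup>2) \<and>
       LD A b c K \<beta> y xs - LD A b c K \<beta> ys xs \<ge> ereal (\<alpha>D / 2 * (infdist y Y)\<^sup>2)"
    using assms unfolding AL_quadratic_growth_def by blast
  define \<alpha> where "\<alpha> = min \<alpha>P \<alpha>D"
  have "ereal (\<alpha> / 2 * (infdist z (Zstar A b c K))\<^sup>2) \<le> smoothed_gap A b c K \<beta> z zs"
    if zs: "zs \<in> Zstar A b c K \<inter> cball z0 r" and z: "z \<in> cball z0 r" for zs z
  proof -
    obtain xs ys x y where [simp]: "zs = (xs, ys)" "z = (x, y)"
      by fastforce
    have opt: "xs \<in> X" "ys \<in> Y"
      using zs by (auto simp: Zstar_def)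
    show ?thesis
    proof (cases "x \<in> K")
      case False
      then show ?thesis
        using smoothed_gap_outside[OF opt] by simp
    next
      case x: True
      obtain s where s: "s \<in> dual_cone K"
        "ereal (w ys \<bullet> x + 1 / (2 * \<beta>) * (norm (A x - b))\<^sup>2
           + (xs \<bullet> s + 1 / (2 * \<beta>) * (norm (w y - s))\<^sup>2)) \<le> smoothed_gap A b c K \<beta> (x, y) (xs, ys)"
        using smoothed_gap_ge[OF opt pos(2) x] by blast
      have P: "\<alpha>P / 2 * (infdist x X)\<^sup>2 \<le> w ys \<bullet> x + 1 / (2 * \<beta>) * (norm (A x - b))\<^sup>2"
        using growth[of xs ys x y] zs z x LP_diff[OF opt, of \<beta> x] by simp
      \<comment> \<open>The \<open>s\<close> obtained from the gap is one candidate in the infimum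
        defining \<open>LD\<close>, so the growth of \<open>LD\<close> bounds its value from
        below.\<close>
      have "ereal (\<alpha>D / 2 * (infdist y Y)\<^sup>2) \<le> LD A b c K \<beta> y xs - LD A b c K \<beta> ys xs"
        using growth[of xs ys x y] zs z by simp
      also note LD_diff_le[OF opt pos(2) s(1)]
      finally have D: "\<alpha>D / 2 * (infdist y Y)\<^sup>2 \<le> xs \<bullet> s + 1 / (2 * \<beta>) * (norm (w y - s))\<^sup>2"
        by simp
      have "\<alpha> / 2 * (infdist z (Zstar A b c K))\<^sup>2 \<le> \<alpha> / 2 * ((infdist x X)\<^sup>2 + (infdist y Y)\<^sup>2)"
        using pos z0_mem infdist_Times_le[OF closed_X closed_Y, of x y]
        by (intro mult_left_mono) (auto simp: \<alpha>_def Zstar_def)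
      also have "\<dots> = \<alpha> / 2 * (infdist x X)\<^sup>2 + \<alpha> / 2 * (infdist y Y)\<^sup>2"
        by (simp add: algebra_simps)
      also have "\<dots> \<le> \<alpha>P / 2 * (infdist x X)\<^sup>2 + \<alpha>D / 2 * (infdist y Y)\<^sup>2"
        by (intro add_mono mult_right_mono) (auto simp: \<alpha>_def)
      also note add_mono[OF P D]
      finally have "ereal (\<alpha> / 2 * (infdist z (Zstar A b c K))\<^sup>2) \<le>
          ereal (w ys \<bullet> x + 1 / (2 * \<beta>) * (norm (A x - b))\<^sup>2
           + (xs \<bullet> s + 1 / (2 * \<beta>) * (norm (w y - s))\<^sup>2))"
        by simp
      also note s(2)
      finally show ?thesis by simp
    qed
  qed
  moreover have "\<alpha> > 0"
    using pos by (simp add: \<alpha>_def)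
  ultimately show ?thesis
    unfolding gap_quadratic_growth_def using pos by blast
qed

lemma subregularity_if_gap_growth:
  assumes "gap_quadratic_growth A b c K z0"
  shows "metric_subregularity A b c K z0"
proof -
  obtain r \<beta> \<alpha> where pos: "r > 0" "\<beta> > 0" "\<alpha> > 0"
    and growth: "\<And>zs z. zs \<in> Zstar A b c K \<inter> cball z0 r \<Longrightarrow> z \<in> cball z0 r \<Longrightarrow>
       ereal (\<alpha> / 2 * (infdist z (Zstar A b c K))\<^sup>2) \<le> smoothed_gap A b c K \<beta> z zs"
    using assms unfolding gap_quadratic_growth_def by blast
  \<comment> \<open>The bound by \<beta> absorbs the quadratic term into
    \<open>\<gamma> / 2 * d\<^sup>2\<close>; the bound by \<open>\<alpha> / 4\<close> then
    contradicts \<open>\<alpha> / 2 \<le> 3 / 2 * \<gamma>\<close>.\<close>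
  define \<gamma> where "\<gamma> = min \<beta> (\<alpha> / 4)"
  have \<gamma>: "\<gamma> > 0" "\<gamma> \<le> \<beta>" "\<gamma> \<le> \<alpha> / 4"
    using pos by (auto simp: \<gamma>_def)
  have closed: "closed (Zstar A b c K)"
    unfolding Zstar_def by (intro closed_Times closed_X closed_Y)
  have "\<gamma> * infdist z (Zstar A b c K) \<le> norm v"
    if z: "z \<in> cball z0 (r / 2)" and v: "v \<in> saddle_subdiff A b c K z" for z v
  proof (rule ccontr)
    define d where "d = infdist z (Zstar A b c K)"
    assume "\<not> \<gamma> * infdist z (Zstar A b c K) \<le> norm v"
    then have less: "norm v < \<gamma> * d"
      by (simp add: d_def)
    then have "0 < \<gamma> * d"
      using norm_ge_zero[of v] by linarith
    then have d: "d > 0"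
      using \<gamma>(1) by (simp add: zero_less_mult_iff)
    obtain zs where zs: "zs \<in> Zstar A b c K" "d = dist z zs"
      using infdist_attains_inf[OF closed] z0 unfolding d_def by blast
    \<comment> \<open>As \<open>z0\<close> is itself a solution, the nearest solution
      \<open>zs\<close> is within twice the distance from \<open>z\<close> to \<open>z0\<close>.
      Halving the radius thus keeps \<open>zs\<close> in the ball of the growth condition.\<close>
    have "d \<le> dist z z0"
      unfolding d_def by (rule infdist_le[OF z0])
    then have "dist z0 zs \<le> r"
      using dist_triangle[of z0 zs z] z zs(2) by (simp add: dist_commute)
    then have "ereal (\<alpha> / 2 * d\<^sup>2) \<le> smoothed_gap A b c K \<beta> z zs"
      unfolding d_def using zs z pos by (intro growth) auto
    also note smoothed_gap_le[OF pos(2) v]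
    finally have "\<alpha> / 2 * d\<^sup>2 \<le> v \<bullet> (z - zs) + 1 / (2 * \<beta>) * (norm v)\<^sup>2"
      by simp
    also have "\<dots> \<le> norm v * d + 1 / (2 * \<beta>) * (norm v)\<^sup>2"
      using norm_cauchy_schwarz[of v "z - zs"] by (simp add: zs(2) dist_norm)
    also have "\<dots> \<le> (\<gamma> * d) * d + 1 / (2 * \<beta>) * (\<gamma> * d)\<^sup>2"
      using less d pos by (intro add_mono mult_right_mono mult_left_mono power_mono) auto
    also have "\<dots> \<le> (\<gamma> * d) * d + (\<gamma> / 2) * d\<^sup>2"
    proof -
      have "1 / (2 * \<beta>) * (\<gamma> * d)\<^sup>2 = \<gamma> / \<beta> * (\<gamma> / 2 * d\<^sup>2)"
        by (simp add: power2_eq_square mult_ac)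
      also have "\<dots> \<le> 1 * (\<gamma> / 2 * d\<^sup>2)"
        using \<gamma> pos by (intro mult_right_mono) auto
      finally show ?thesis by simp
    qed
    also have "\<dots> = (3 / 2 * \<gamma>) * d\<^sup>2"
      by (simp add: power2_eq_square)
    finally have "\<alpha> / 2 \<le> 3 / 2 * \<gamma>"
      using d by simp
    then show False
      using \<gamma> pos by linarith
  qed
  \<comment> \<open>A bound for each element suffices; over an empty subdifferential the infimum is
    infinite.\<close>
  then have "\<forall>z\<in>cball z0 (r / 2).
      ereal (\<gamma> * infdist z (Zstar A b c K)) \<le> edist_to 0 (saddle_subdiff A b c K z)"
    by (auto simp: edist_to_def dist_norm intro!: INF_greatest)
  then show ?thesis
    unfolding metric_subregularity_def using pos \<gamma> by (meson half_gt_zero)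
qed

section \<open>From subregularity to augmented Lagrangian growth\<close>

context
  fixes r \<gamma> :: real
  assumes r: "r > 0" and \<gamma>: "\<gamma> > 0"
    and subreg: "\<And>z. z \<in> cball z0 r \<Longrightarrow>
      ereal (\<gamma> * infdist z (Zstar A b c K)) \<le> edist_to 0 (saddle_subdiff A b c K z)"
begin

lemma subregularityD:
  assumes "n \<in> normal_cone K x" and "dist x (fst z0) \<le> r / 2" "dist y (snd z0) \<le> r / 2"
  shows "\<gamma> * infdist (x, y) (X \<times> Y) \<le> norm (w y + n) + norm (b - A x)"
proof -
  have "dist z0 (x, y) = norm (fst z0 - x, snd z0 - y)"
    by (metis dist_norm diff_Pair prod.collapse)
  also have "\<dots> \<le> r"
    using norm_Pair_le_add[of "fst z0 - x" "snd z0 - y"] assms(2,3)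
    by (simp add: dist_norm norm_minus_commute)
  finally have "ereal (\<gamma> * infdist (x, y) (X \<times> Y)) \<le> edist_to 0 (saddle_subdiff A b c K (x, y))"
    using subreg[of "(x, y)"] by (simp add: Zstar_def)
  also have "\<dots> \<le> ereal (dist 0 (w y + n, b - A x))"
    unfolding edist_to_def by (rule INF_lower) (use assms(1) in \<open>auto simp: saddle_subdiff_def\<close>)
  finally show ?thesis
    using norm_Pair_le_add[of "w y + n" "b - A x"] by simp
qed

lemma primal_growth:
  assumes opt: "xs \<in> X" "ys \<in> Y" and ys: "dist ys (snd z0) \<le> r / 4"
    and x: "x \<in> K" "dist x (fst z0) \<le> r / 4"
  shows "(\<gamma>\<^sup>2 / (2 * (1 + \<gamma>)\<^sup>2)) / 2 * (infdist x X)\<^sup>2 \<le> w ys \<bullet> x + 1/2 * (norm (A x - b))\<^sup>2"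
proof -
  have sq: "(norm ((A v, v) - (b, x)))\<^sup>2 = (norm (A v - b))\<^sup>2 + (norm (v - x))\<^sup>2" for v
    by (simp add: norm_Pair)
  have lin: "linear (\<lambda>v. (A v, v))"
    using linear_A by (auto intro!: linearI simp: linear_add linear_cmul)
  have inj: "inj (\<lambda>v. (A v, v))"
    by (auto intro: injI)
  have K: "convex K" "K \<noteq> {}"
    using cone_K by (auto simp: convex_cone_def)
  have nonneg: "0 \<le> w ys \<bullet> v" if "v \<in> K" for v
    using ys_feasible[OF opt] that by (auto simp: dual_cone_def)
  \<comment> \<open>Here \<open>u\<close> is the proximal point: the second component of the stacked
    map contributes the term \<open>norm (v - x)\<close>.\<close>
  obtain u where u: "u \<in> K"
    and min: "\<And>v. v \<in> K \<Longrightarrow> w ys \<bullet> u + 1/2 * (norm ((A u, u) - (b, x)))\<^sup>2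
        \<le> w ys \<bullet> v + 1/2 * (norm ((A v, v) - (b, x)))\<^sup>2"
    and vi: "\<And>v. v \<in> K \<Longrightarrow>
        0 \<le> w ys \<bullet> (v - u) + ((A u, u) - (b, x)) \<bullet> (A (v - u), v - u)"
    using regularized_least_squares[OF closed_K K lin inj nonneg, of "(b, x)"] by blast
  define a where "a = norm (u - x)"
  define e where "e = norm (A u - b)"
  have le_x: "1/2 * e\<^sup>2 + 1/2 * a\<^sup>2 \<le> w ys \<bullet> x + 1/2 * (norm (A x - b))\<^sup>2"
    using min[OF x(1)] nonneg[OF u] unfolding sq a_def e_def by (simp add: algebra_simps)
  \<comment> \<open>Compare with the solution \<open>fst z0\<close>, where complementarity kills the
    linear term and feasibility the penalty. This keeps the proximal step and the multiplier update
    inside the ball.\<close>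
  have "w ys \<bullet> u + 1/2 * (e\<^sup>2 + a\<^sup>2) \<le> 1/2 * (dist x (fst z0))\<^sup>2"
    using min[of "fst z0"] xs_feasible[OF z0_mem] complementarity[OF z0_mem(1) opt(2)]
    unfolding sq a_def e_def by (simp add: dist_norm norm_minus_commute)
  then have "e\<^sup>2 + a\<^sup>2 \<le> (dist x (fst z0))\<^sup>2"
    using nonneg[OF u] by argo
  then have "e\<^sup>2 \<le> (dist x (fst z0))\<^sup>2" "a\<^sup>2 \<le> (dist x (fst z0))\<^sup>2"
    using zero_le_power2[of e] zero_le_power2[of a] by linarith+
  then have small: "e \<le> r / 4" "a \<le> r / 4"
    using x(2) power2_le_imp_le[of _ "dist x (fst z0)"] by fastforce+
  \<comment> \<open>The multiplier update absorbs the gradient of the penalty, leaving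
    \<open>x - u\<close> and \<open>b - A u\<close> as residual in the subdifferential at
    \<open>(u, y)\<close>.\<close>
  define y where "y = ys + (A u - b)"
  have "- (w y + (u - x)) \<in> normal_cone K u"
  proof -
    have "adjoint A y = adjoint A ys + adjoint A (A u - b)"
      unfolding y_def by (rule linear_add[OF linear_adjoint])
    then have "(w y + (u - x)) \<bullet> v = w ys \<bullet> v + ((A u, u) - (b, x)) \<bullet> (A v, v)" for v
      by (simp add: inner_add_left inner_adjoint inner_commute[of "A v"])
    then show ?thesis
      using u vi by (simp add: normal_cone_def del: minus_add_distrib)
  qed
  moreover have "dist u (fst z0) \<le> r / 2"
    using dist_triangle[of u "fst z0" x] small(2) x(2) by (simp add: a_def dist_norm)
  moreover have "dist y (snd z0) \<le> r / 2"
    using dist_triangle[of y "snd z0" ys] small(1) ys by (simp add: y_def e_def dist_norm)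
  ultimately have "\<gamma> * infdist (u, y) (X \<times> Y) \<le> norm (w y + - (w y + (u - x))) + norm (b - A u)"
    by (rule subregularityD)
  moreover have "\<gamma> * infdist u X \<le> \<gamma> * infdist (u, y) (X \<times> Y)"
    using \<gamma> z0_mem by (intro mult_left_mono infdist_fst_le) auto
  ultimately have "\<gamma> * infdist u X \<le> a + e"
    by (simp add: a_def e_def norm_minus_commute)
  moreover have "infdist x X \<le> infdist u X + a"
    using infdist_triangle[of x X u] by (simp add: a_def dist_norm norm_minus_commute)
  ultimately show ?thesis
    using \<gamma> le_x by (intro quadratic_growth_estimate[of \<gamma> a e]) (auto simp: a_def e_def infdist_nonneg)
qed

text \<open>The bound is claimed for every \<open>t\<close> in the dual cone, so that it passes to
  the infimum defining \<open>LD\<close>.\<close>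

lemma dual_growth:
  assumes opt: "xs \<in> X" "ys \<in> Y" and xs: "dist xs (fst z0) \<le> r / 4"
    and y: "dist y (snd z0) \<le> r / 4" and t: "t \<in> dual_cone K"
  shows "(\<gamma>\<^sup>2 / (2 * (1 + \<gamma>)\<^sup>2)) / 2 * (infdist y Y)\<^sup>2 \<le> xs \<bullet> t + 1/2 * (norm (w y - t))\<^sup>2"
proof -
  \<comment> \<open>The proximal point is found jointly with its slack \<open>s\<close>:
    \<open>B\<close> and \<open>q\<close> are chosen so that \<open>B (u, s) - q\<close> collects
    the dual infeasibility \<open>w u - s\<close> and the step \<open>u - y\<close>.\<close>
  define B where "B v = (adjoint A (fst v) - snd v, fst v)" for v
  define q where "q = (- c, y)"
  define S where "S = (UNIV :: 'f set) \<times> dual_cone K"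
  have B: "B (u, s) - q = (w u - s, u - y)" for u s
    by (simp add: B_def q_def)
  have sq: "(norm (B (u, s) - q))\<^sup>2 = (norm (w u - s))\<^sup>2 + (norm (u - y))\<^sup>2" for u s
    by (simp add: B norm_Pair)
  have lin: "linear B"
    using linear_adjoint
    by (auto intro!: linearI simp: B_def linear_add linear_cmul algebra_simps)
  have inj: "inj B"
    by (auto intro!: injI simp: B_def prod_eq_iff)
  have S: "closed S" "convex S" "S \<noteq> {}"
    using t by (auto simp: S_def closed_Times closed_dual_cone convex_Times convex_dual_cone)
  have nonneg: "0 \<le> (0, xs) \<bullet> v" if "v \<in> S" for v
    using that inner_dual_cone_nonneg[OF opt] by (auto simp: S_def)
  obtain us where us: "us \<in> S"
    and min0: "\<And>v. v \<in> S \<Longrightarrow> (0, xs) \<bullet> us + 1/2 * (norm (B us - q))\<^sup>2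
        \<le> (0, xs) \<bullet> v + 1/2 * (norm (B v - q))\<^sup>2"
    and vi0: "\<And>v. v \<in> S \<Longrightarrow> 0 \<le> (0, xs) \<bullet> (v - us) + (B us - q) \<bullet> B (v - us)"
    using regularized_least_squares[OF S lin inj nonneg, of q] by blast
  obtain u s where us_eq: "us = (u, s)"
    by fastforce
  define \<epsilon> where "\<epsilon> = w u - s"
  have s: "s \<in> dual_cone K"
    using us by (simp add: us_eq S_def)
  have min: "xs \<bullet> s + 1/2 * ((norm \<epsilon>)\<^sup>2 + (norm (u - y))\<^sup>2)
      \<le> xs \<bullet> s' + 1/2 * ((norm (w u' - s'))\<^sup>2 + (norm (u' - y))\<^sup>2)" if "s' \<in> dual_cone K" for u' s'
    using min0[of "(u', s')"] that unfolding us_eq sq by (simp add: S_def \<epsilon>_def)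
  have vi: "0 \<le> xs \<bullet> (s' - s) + \<epsilon> \<bullet> (adjoint A (u' - u) - (s' - s)) + (u - y) \<bullet> (u' - u)"
    if "s' \<in> dual_cone K" for u' s'
    using vi0[of "(u', s')"] that unfolding us_eq B by (simp add: S_def \<epsilon>_def B_def)
  \<comment> \<open>The variable \<open>u\<close> is unconstrained, so its gradient
    \<open>A \<epsilon> + (u - y)\<close> vanishes; test against its negative.\<close>
  have A\<epsilon>: "A \<epsilon> = y - u"
  proof -
    have "0 \<le> (A \<epsilon> + (u - y)) \<bullet> (u' - u)" for u'
      using vi[OF s, of u'] by (simp add: inner_adjoint inner_add_left)
    from this[of "u + - (A \<epsilon> + (u - y))"] have "(A \<epsilon> + (u - y)) \<bullet> (A \<epsilon> + (u - y)) \<le> 0"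
      by (simp only: add_diff_cancel_left' inner_minus_right neg_0_le_iff_le)
    then have "A \<epsilon> + (u - y) = 0"
      using inner_gt_zero_iff[of "A \<epsilon> + (u - y)"] by (meson not_le)
    then show ?thesis
      by (simp add: algebra_simps eq_neg_iff_add_eq_0)
  qed
  \<comment> \<open>The updated primal multiplier. Variation of \<open>s\<close> puts it in the
    bidual cone, which is \<open>K\<close>, and makes it orthogonal to \<open>s\<close>. The
    residual at \<open>(x, u)\<close> is then \<open>(\<epsilon>, y - u)\<close>.\<close>
  define x where "x = xs - \<epsilon>"
  have x_vi: "0 \<le> x \<bullet> (s' - s)" if "s' \<in> dual_cone K" for s'
    using vi[OF that, of u] linear_0[OF linear_adjoint]
    by (simp add: x_def inner_diff_left inner_diff_right)
  have "2 *\<^sub>R s \<in> dual_cone K" "0 \<in> dual_cone K"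
    using s scaleR_dual_cone[of s K 2] by (simp_all add: dual_cone_def)
  from x_vi[OF this(1)] x_vi[OF this(2)] have xs_orth: "x \<bullet> s = 0"
    by (simp add: scaleR_2)
  then have "x \<in> K"
    using x_vi by (intro bipolar[OF closed_K cone_K]) (simp add: inner_diff_right inner_commute)
  then have normal: "- s \<in> normal_cone K x"
    using s xs_orth by (intro normal_coneI) (auto simp: inner_commute)
  define a where "a = norm (u - y)"
  define e where "e = norm \<epsilon>"
  have s_nonneg: "0 \<le> xs \<bullet> s"
    by (rule inner_dual_cone_nonneg[OF opt s])
  have le_t: "1/2 * e\<^sup>2 + 1/2 * a\<^sup>2 \<le> xs \<bullet> t + 1/2 * (norm (w y - t))\<^sup>2"
    using min[OF t, of y] s_nonneg unfolding a_def e_def by (simp add: algebra_simps)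
  \<comment> \<open>Compare with the dual solution \<open>snd z0\<close> and its slack, which is
    orthogonal to \<open>xs\<close>.\<close>
  have "xs \<bullet> s + 1/2 * (e\<^sup>2 + a\<^sup>2) \<le> 1/2 * (dist y (snd z0))\<^sup>2"
    using min[OF ys_feasible[OF z0_mem], of "snd z0"] complementarity[OF opt(1) z0_mem(2)]
    unfolding a_def e_def by (simp add: dist_norm norm_minus_commute inner_commute[of xs])
  then have "e\<^sup>2 + a\<^sup>2 \<le> (dist y (snd z0))\<^sup>2"
    using s_nonneg by argo
  then have "e\<^sup>2 \<le> (dist y (snd z0))\<^sup>2" "a\<^sup>2 \<le> (dist y (snd z0))\<^sup>2"
    using zero_le_power2[of e] zero_le_power2[of a] by linarith+
  then have small: "e \<le> r / 4" "a \<le> r / 4"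
    using y power2_le_imp_le[of _ "dist y (snd z0)"] by fastforce+
  have "dist x (fst z0) \<le> r / 2"
    using dist_triangle[of x "fst z0" xs] small(1) xs by (simp add: x_def e_def dist_norm)
  moreover have "dist u (snd z0) \<le> r / 2"
    using dist_triangle[of u "snd z0" y] small(2) y by (simp add: a_def dist_norm)
  ultimately have "\<gamma> * infdist (x, u) (X \<times> Y) \<le> norm (w u + - s) + norm (b - A x)"
    by (rule subregularityD[OF normal])
  moreover have "b - A x = y - u"
    using xs_feasible[OF opt] linear_diff[OF linear_A] by (simp add: x_def A\<epsilon>)
  moreover have "\<gamma> * infdist u Y \<le> \<gamma> * infdist (x, u) (X \<times> Y)"
    using \<gamma> z0_mem by (intro mult_left_mono infdist_snd_le) auto
  ultimately have "\<gamma> * infdist u Y \<le> a + e"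
    by (simp add: a_def e_def \<epsilon>_def norm_minus_commute)
  moreover have "infdist y Y \<le> infdist u Y + a"
    using infdist_triangle[of y Y u] by (simp add: a_def dist_norm norm_minus_commute)
  ultimately show ?thesis
    using \<gamma> le_t by (intro quadratic_growth_estimate[of \<gamma> a e]) (auto simp: a_def e_def infdist_nonneg)
qed

end

lemma AL_growth_if_subregularity:
  assumes "metric_subregularity A b c K z0"
  shows "AL_quadratic_growth A b c K z0"
proof -
  obtain r \<gamma> where r: "r > 0" and \<gamma>: "\<gamma> > 0"
    and subreg: "\<And>z. z \<in> cball z0 r \<Longrightarrow>
      ereal (\<gamma> * infdist z (Zstar A b c K)) \<le> edist_to 0 (saddle_subdiff A b c K z)"
    using assms unfolding metric_subregularity_def by blast
  define \<alpha> where "\<alpha> = \<gamma>\<^sup>2 / (2 * (1 + \<gamma>)\<^sup>2)"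
  \<comment> \<open>Radius \<open>r / 4\<close>: the given points and the corrections to them each
    cost at most \<open>r / 4\<close> per component, and the two components together stay within
    \<open>r\<close>.\<close>
  have "ereal (\<alpha> / 2 * (infdist x X)\<^sup>2) \<le> LP A b c K 1 x ys - LP A b c K 1 xs ys \<and>
      ereal (\<alpha> / 2 * (infdist y Y)\<^sup>2) \<le> LD A b c K 1 y xs - LD A b c K 1 ys xs"
    if zs: "(xs, ys) \<in> Zstar A b c K \<inter> cball z0 (r / 4)" and z: "(x, y) \<in> cball z0 (r / 4)"
    for xs ys x y
  proof
    have opt: "xs \<in> X" "ys \<in> Y"
      using zs by (auto simp: Zstar_def)
    have near: "dist x (fst z0) \<le> r / 4" "dist y (snd z0) \<le> r / 4"
      "dist xs (fst z0) \<le> r / 4" "dist ys (snd z0) \<le> r / 4"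
      using z zs dist_fst_le[of "(x, y)" z0] dist_snd_le[of "(x, y)" z0]
        dist_fst_le[of "(xs, ys)" z0] dist_snd_le[of "(xs, ys)" z0]
      by (auto simp: dist_commute)
    show "ereal (\<alpha> / 2 * (infdist x X)\<^sup>2) \<le> LP A b c K 1 x ys - LP A b c K 1 xs ys"
      using primal_growth[OF r \<gamma> subreg opt near(4) _ near(1)]
      by (simp add: LP_diff[OF opt] \<alpha>_def)
    show "ereal (\<alpha> / 2 * (infdist y Y)\<^sup>2) \<le> LD A b c K 1 y xs - LD A b c K 1 ys xs"
      using dual_growth[OF r \<gamma> subreg opt near(3,2)]
      by (intro LD_diff_ge[OF opt]) (simp_all add: \<alpha>_def)
  qed
  moreover have "\<alpha> > 0" "r / 4 > 0"
    using r \<gamma> by (simp_all add: \<alpha>_def zero_less_divide_iff)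
  ultimately show ?thesis
    unfolding AL_quadratic_growth_def using zero_less_one by blast
qed

end

theorem mainTheorem2:
  fixes A :: "'e::euclidean_space \<Rightarrow> 'f::euclidean_space"
    and b :: 'f and c :: 'e and K :: "'e set" and z0 :: "'e \<times> 'f"
  assumes "linear A"
    and "closed K" and "convex_cone K"
    and "z0 \<in> Zstar A b c K"
    and strong_duality: "c \<bullet> fst z0 = - (b \<bullet> snd z0)"
  shows "(AL_quadratic_growth A b c K z0 \<longleftrightarrow> gap_quadratic_growth A b c K z0) \<and>
         (gap_quadratic_growth A b c K z0 \<longleftrightarrow> metric_subregularity A b c K z0)"
proof -
  interpret conic_program A b c K z0
    by (rule conic_program.intro[OF assms])
  show ?thesis
    using gap_growth_if_AL_growth subregularity_if_gap_growth AL_growth_if_subregularity by blast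
qed

end
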